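(* Let $F\in\mathcal{F}$. If $\mathcal{N}(F)\subseteq\mathbb{R}$ then $F\in\mathcal{F}_{\mathrm{dist}}$, i.e. the sequence $(s_n(F))_{n\ge0}$ is the moment sequence of a probability distribution on $\mathbb{R}$.
   Context: $\mathcal{F}$ is the set of rational functions $F(w)=wP(w)/Q(w)$, where $P,Q\in\mathbb{R}[w]$ are relatively prime polynomials with $P(0)=Q(0)=1$. For $F\in\mathcal{F}$ let $D(z)=z\sum_{n\ge0}s_n(F)z^n$ be the compositional inverse of $F$ near $0$ (so $F(D(z))=z$, $D(0)=0$, $s_0(F)=1$). $\mathcal{F}_{\mathrm{dist}}$ is the set of $F\in\mathcal{F}$ such that $(s_n(F))_{n\ge0}$ is positive definite, i.e. there is a probability distribution $\mu$ on $\mathbb{R}$ with $s_n(F)=\int_{\mathbb{R}}x^n\,\mu(dx)$ for all $n\ge 0$. $\mathcal{N}(F)$ is the set of all $z_0\in\mathbb{C}$ such that the polynomial $wP(w)-z_0Q(w)$ (in $w$) has a multiple root $w_0\in\mathbb{C}$; equivalently $F(w_0)=z_0$ and $F'(w_0)=0$ for some $w_0\in\mathbb{C}$. *)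

theory Defs
  imports
    "HOL-Computational_Algebra.Computational_Algebra"
    "HOL-Computational_Algebra.Field_as_Ring"
    "HOL-Probability.Probability"
begin

definition represents :: "real poly fract \<Rightarrow> real poly \<Rightarrow> real poly \<Rightarrow> bool" where
  "represents F P Q \<longleftrightarrow>
     coprime P Q \<and> poly P 0 = 1 \<and> poly Q 0 = 1 \<and> F = Fract ([:0, 1:] * P) Q"

definition rat_class :: "real poly fract set" where
  "rat_class = {F. \<exists>P Q. represents F P Q}"

text \<open>
  The power series expansion at the origin. It is only used for rational functions
  whose reduced denominator does not vanish at 0, in particular on \<^const>\<open>rat_class\<close>.
\<close>
definition taylor :: "real poly fract \<Rightarrow> real fps" where
  "taylor F = fps_of_poly (fst (quot_of_fract F)) / fps_of_poly (snd (quot_of_fract F))"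

definition comp_inverse :: "real poly fract \<Rightarrow> real fps" where
  "comp_inverse F = fps_inv (taylor F)"

definition s_coeff :: "real poly fract \<Rightarrow> nat \<Rightarrow> real" where
  "s_coeff F n = fps_nth (comp_inverse F) (Suc n)"

definition rat_class_dist :: "real poly fract set" where
  "rat_class_dist =
     {F \<in> rat_class. \<exists>\<mu>. real_distribution \<mu> \<and>
        (\<forall>n. integrable \<mu> (\<lambda>x. x ^ n) \<and> s_coeff F n = (\<integral>x. x ^ n \<partial>\<mu>))}"

definition level_poly :: "real poly \<Rightarrow> real poly \<Rightarrow> complex \<Rightarrow> complex poly" where
  "level_poly P Q z =
     [:0, 1:] * map_poly complex_of_real P - smult z (map_poly complex_of_real Q)"

text \<open>
  The pair \<open>P\<close>, \<open>Q\<close> is uniquely determined by \<open>F\<close>, and \<^const>\<open>level_poly\<close> is never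
  the zero polynomial for such a pair (both are proved below), so \<^const>\<open>order\<close> is the
  usual root multiplicity here.
\<close>
definition crit_values :: "real poly fract \<Rightarrow> complex set" where
  "crit_values F =
     {z. \<exists>P Q. represents F P Q \<and> (\<exists>w. order w (level_poly P Q z) \<ge> 2)}"

lemma level_poly_nonzero:
  assumes "represents F P Q"
  shows "level_poly P Q z \<noteq> 0"
proof
  assume *: "level_poly P Q z = 0"
  have P: "coeff P 0 = 1" and Q: "coeff Q 0 = 1"
    using assms by (auto simp: represents_def poly_0_coeff_0)
  have "coeff (level_poly P Q z) 0 = 0" by (simp add: *)
  hence "z = 0" using Q by (simp add: level_poly_def coeff_map_poly)
  moreover have "coeff (level_poly P Q z) 1 = 0" by (simp add: *)
  ultimately show False
    using P by (simp add: level_poly_def coeff_map_poly)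
qed

lemma represents_unique:
  assumes "represents F P Q" "represents F P' Q'"
  shows "P' = P" "Q' = Q"
proof -
  have cop: "coprime P Q" "coprime P' Q'" using assms by (auto simp: represents_def)
  have nz: "Q \<noteq> 0" "Q' \<noteq> 0" using assms by (auto simp: represents_def)
  have "[:0, 1:] * P * Q' = [:0, 1:] * P' * Q"
    using assms nz by (auto simp: represents_def eq_fract)
  hence "[:0, 1:] * (P * Q') = [:0, 1:] * (P' * Q)" by (simp only: mult.assoc)
  hence eq: "P * Q' = P' * Q" by (subst (asm) mult_cancel_left) auto
  have "Q dvd P * Q'" "Q' dvd P' * Q" using eq by (metis dvd_triv_right)+
  hence "Q dvd Q'" "Q' dvd Q"
    using cop by (metis coprime_commute coprime_dvd_mult_right_iff)+
  then obtain k where k: "Q' = Q * k" by (auto elim: dvdE)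
  hence "degree k = 0"
    using dvd_imp_degree_le[OF \<open>Q' dvd Q\<close> nz(1)] nz by (auto simp: degree_mult_eq)
  then obtain c where "k = [:c:]" by (rule degree_eq_zeroE)
  with k have c: "Q' = smult c Q" by simp
  hence "c = 1" using assms by (auto simp: represents_def)
  thus Q: "Q' = Q" using c by simp
  thus "P' = P" using eq nz by simp
qed

lemma taylor_eq:
  assumes "represents F P Q"
  shows "taylor F = fps_X * fps_of_poly P / fps_of_poly Q"
proof -
  define a b where "a = fst (quot_of_fract F)" and "b = snd (quot_of_fract F)"
  have F: "F = Fract a b" and b: "b \<noteq> 0" by (simp_all add: a_def b_def)
  have cop: "coprime a b" using coprime_quot_of_fract[of F] by (simp add: a_def b_def)
  have Q0: "poly Q 0 = 1" and F': "F = Fract ([:0, 1:] * P) Q"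
    using assms by (auto simp: represents_def)
  have "Q \<noteq> 0" using Q0 by auto
  have eq: "a * Q = [:0, 1:] * P * b" using F F' b \<open>Q \<noteq> 0\<close> by (simp add: eq_fract)
  hence "b dvd a * Q" by (metis dvd_triv_right)
  hence "b dvd Q" using cop by (metis coprime_commute coprime_dvd_mult_right_iff)
  hence "poly b 0 \<noteq> 0" using Q0 by (auto elim!: dvdE)
  have u: "is_unit (fps_of_poly b)" "is_unit (fps_of_poly Q)"
    using \<open>poly b 0 \<noteq> 0\<close> Q0 by (simp_all add: fps_is_unit_iff poly_0_coeff_0)
  have "fps_of_poly a * fps_of_poly Q = fps_X * fps_of_poly P * fps_of_poly b"
    using arg_cong[OF eq, of fps_of_poly]
    by (simp add: fps_of_poly_mult fps_of_poly_pCons)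
  thus ?thesis using u unfolding taylor_def a_def[symmetric] b_def[symmetric]
    by (metis unit_eq_div1 unit_div_mult_swap mult.commute)
qed

lemma comp_inverse:
  assumes "F \<in> rat_class"
  shows "fps_nth (comp_inverse F) 0 = 0" "taylor F oo comp_inverse F = fps_X" "s_coeff F 0 = 1"
proof -
  obtain P Q where r: "represents F P Q" using assms by (auto simp: rat_class_def)
  have P: "coeff P 0 = 1" and Q: "coeff Q 0 = 1"
    using r by (auto simp: represents_def poly_0_coeff_0)
  have t: "taylor F = fps_X * (fps_of_poly P * inverse (fps_of_poly Q))"
    using Q by (simp add: taylor_eq[OF r] fps_divide_unit mult.assoc)
  have t0: "fps_nth (taylor F) 0 = 0" unfolding t by simp
  have t1: "fps_nth (taylor F) 1 = 1" unfolding t using P Q by simp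
  show "fps_nth (comp_inverse F) 0 = 0" by (simp add: comp_inverse_def fps_inv_def)
  show "taylor F oo comp_inverse F = fps_X"
    unfolding comp_inverse_def by (rule fps_inv_right) (use t0 t1 in auto)
  show "s_coeff F 0 = 1"
    using t0 t1 by (simp add: s_coeff_def comp_inverse_def fps_inv_def)
qed

end

theory Submission
  imports Defs "HOL-Complex_Analysis.Complex_Analysis"
begin

text \<open>
  The value of \<open>F\<close> at infinity is real or infinite, so \<open>F\<close> is proper as a map from the part of
  the upper half-plane on which \<open>Im F > 0\<close> to the upper half-plane. If all critical values
  are real, this map has no critical points, hence is a covering. As the upper half-plane is
  simply connected, the branch of the inverse of \<open>F\<close> at 0 extends to a holomorphic self-map \<open>g\<close>
  of the upper half-plane. By Cauchy's theorem, the moments of the densities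
  \<open>Im (g (1 / (x - i \<epsilon>))) / \<pi>\<close> on a large interval \<open>[- R, R]\<close> are the imaginary parts of integrals
  over the lower half of the circle of radius \<open>R\<close>, where \<open>g\<close> is given by its power series; as
  \<open>\<epsilon>\<close> tends to 0, they tend to the coefficients. By Helly's theorem, the measures have a weak
  limit point, whose moments are the coefficients.
\<close>

section \<open>Proper holomorphic maps are coverings\<close>

text \<open>A nonvanishing derivative makes \<open>p\<close> locally injective, and properness makes
  fibres compact, hence finite. Properness also keeps preimages of points near \<open>y\<close>
  close to the fibre over \<open>y\<close>, so that small discs around the fibre points, cut down to
  a common image, are the sheets.\<close>

lemma covering_space_proper_holomorphic:
  fixes p :: "complex \<Rightarrow> complex"
  assumes C: "open C" "C \<noteq> {}" and S: "open S" "connected S"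
    and hol: "p holomorphic_on C" and img: "p ` C \<subseteq> S"
    and der: "\<And>w. w \<in> C \<Longrightarrow> deriv p w \<noteq> 0"
    and proper: "\<And>K. \<lbrakk>compact K; K \<subseteq> S\<rbrakk> \<Longrightarrow> compact (C \<inter> p -` K)"
  shows "covering_space C p S"
proof
  show cont: "continuous_on C p" using hol by (rule holomorphic_on_imp_continuous_on)
  obtain \<delta> where \<delta>: "\<And>w. w \<in> C \<Longrightarrow> \<delta> w > 0 \<and> ball w (\<delta> w) \<subseteq> C \<and> inj_on p (ball w (\<delta> w))"
  proof -
    have "\<exists>d>0. ball w d \<subseteq> C \<and> inj_on p (ball w d)" if "w \<in> C" for w
      using has_complex_derivative_locally_injective[OF hol that C(1) der[OF that]] by blast
    then show ?thesis using that by metis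
  qed
  have open_image: "open (p ` U)" if "open U" "U \<subseteq> C" "inj_on p U" for U
    by (rule open_mapping_thm3[OF holomorphic_on_subset[OF hol]]) (fact that)+
  have compact_image: "compact (p ` (C \<inter> p -` K))" if "compact K" "K \<subseteq> S" for K
    by (rule compact_continuous_image[OF continuous_on_subset[OF cont] proper[OF that]]) simp
  \<comment> \<open>The image is open by the open mapping theorem and relatively closed by
    properness, and \<open>S\<close> is connected.\<close>
  show surj: "p ` C = S"
  proof -
    have "openin (top_of_set S) (p ` C)"
    proof -
      have "p ` C = (\<Union>w\<in>C. p ` ball w (\<delta> w))"
        using \<delta> by (force simp: image_UN[symmetric])
      moreover have "open (\<Union>w\<in>C. p ` ball w (\<delta> w))"
        using \<delta> open_image by (intro open_UN) auto
      ultimately show ?thesis using img S by (simp add: openin_open_eq)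
    qed
    moreover have "openin (top_of_set S) (S - p ` C)"
    proof -
      have "\<exists>e>0. ball y e \<subseteq> S - p ` C" if "y \<in> S - p ` C" for y
      proof -
        obtain e where e: "e > 0" "cball y e \<subseteq> S"
          using S(1) \<open>y \<in> S - p ` C\<close> open_contains_cball by (metis DiffD1)
        let ?K = "p ` (C \<inter> p -` cball y e)"
        have "closed ?K" by (intro compact_imp_closed compact_image e) auto
        then have "open (ball y e - ?K)" by auto
        moreover have "y \<in> ball y e - ?K" using that e by auto
        ultimately obtain e' where e': "e' > 0" "ball y e' \<subseteq> ball y e - ?K"
          by (rule openE)
        have "x \<in> S - p ` C" if x: "x \<in> ball y e'" for x
        proof -
          have "x \<in> ball y e" "x \<notin> ?K" using x e' by auto
          then show ?thesis using e(2) by auto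
        qed
        then have "ball y e' \<subseteq> S - p ` C" by blast
        then show ?thesis using e' by blast
      qed
      then have "open (S - p ` C)" unfolding open_contains_ball by blast
      then show ?thesis using S by (simp add: openin_open_eq)
    qed
    ultimately show ?thesis
      using S(2) C(2) img by (auto simp: connected_clopen closedin_def)
  qed
  fix y assume y: "y \<in> S"
  define A where "A = C \<inter> p -` {y}"
  \<comment> \<open>The fibre is compact, and each ball around one of its points contains no
    other.\<close>
  have "finite A"
  proof -
    have "compact A" unfolding A_def using y by (intro proper) auto
    moreover have "A \<subseteq> (\<Union>w\<in>A. ball w (\<delta> w))" using \<delta> by (force simp: A_def)
    ultimately obtain A' where A': "A' \<subseteq> A" "finite A'" "A \<subseteq> (\<Union>w\<in>A'. ball w (\<delta> w))"
      using compactE_image[of A A "\<lambda>w. ball w (\<delta> w)"] by auto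
    have "A \<subseteq> A'"
    proof
      fix x assume "x \<in> A"
      then obtain w where w: "w \<in> A'" "x \<in> ball w (\<delta> w)" using A' by auto
      then have "w \<in> C" "p x = p w" using A' \<open>x \<in> A\<close> by (auto simp: A_def)
      then have "x = w" using \<delta>[of w] w by (auto dest: inj_onD)
      then show "x \<in> A'" using w by simp
    qed
    then show ?thesis using A'(2) finite_subset by blast
  qed
  have "\<exists>d>0. \<forall>x\<in>A. x \<noteq> w \<longrightarrow> d \<le> dist w x" for w
    using finite_set_avoid[OF \<open>finite A\<close>] by blast
  then obtain \<eta> where \<eta>: "\<And>w. \<eta> w > 0" "\<And>w x. \<lbrakk>x \<in> A; x \<noteq> w\<rbrakk> \<Longrightarrow> \<eta> w \<le> dist w x"
    by metis
  \<comment> \<open>The bound \<open>\<delta> w\<close> keeps \<open>p\<close> injective; half the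
    distance to the other fibre points keeps the balls disjoint.\<close>
  define B where "B w = ball w (min (\<delta> w) (\<eta> w / 2))" for w
  have B: "open (B w)" "w \<in> B w" "B w \<subseteq> C" "inj_on p (B w)" if "w \<in> A" for w
    using \<delta>[of w] \<eta>[of w] that by (auto simp: B_def A_def intro: inj_on_subset)
  have B_disj: "B w \<inter> B w' = {}" if "w \<in> A" "w' \<in> A" "w \<noteq> w'" for w w'
  proof -
    have "\<eta> w \<le> dist w w'" "\<eta> w' \<le> dist w w'"
      using \<eta>(2)[of w' w] \<eta>(2)[of w w'] that by (auto simp: dist_commute)
    then show ?thesis unfolding B_def by (intro disjoint_ballI) auto
  qed
  define W where "W = S \<inter> (\<Inter>w\<in>A. p ` B w)"
  have "open W" unfolding W_def
    by (intro open_Int S open_INT \<open>finite A\<close> ballI open_image B)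
  moreover have "y \<in> W" unfolding W_def using y B(2) by (auto simp: A_def)
  ultimately obtain e where e: "e > 0" "cball y e \<subseteq> W"
    by (meson open_contains_cball)
  \<comment> \<open>The points over the closed disc outside all the balls form a compact set without
    fibre points. Removing its image from the disc leaves a neighbourhood \<open>T\<close> of
    \<open>y\<close> whose whole preimage lies in the balls.\<close>
  define K where "K = (C \<inter> p -` cball y e) - (\<Union>w\<in>A. B w)"
  have "compact K" unfolding K_def
    using e by (intro compact_diff proper open_UN B ballI) (auto simp: W_def)
  moreover have "K \<subseteq> C" by (auto simp: K_def)
  ultimately have "compact (p ` K)"
    by (intro compact_continuous_image continuous_on_subset[OF cont])
  define T where "T = ball y e - p ` K"
  have "open T" unfolding T_def using compact_imp_closed[OF \<open>compact (p ` K)\<close>] by auto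
  have "T \<subseteq> W" using e(2) by (auto simp: T_def)
  have "y \<notin> p ` K"
  proof
    assume "y \<in> p ` K"
    then obtain x where x: "x \<in> K" "p x = y" by auto
    then have "x \<in> A" by (auto simp: K_def A_def)
    with x B(2) show False by (auto simp: K_def)
  qed
  then have "y \<in> T" using e by (auto simp: T_def)
  let ?v = "(\<lambda>w. B w \<inter> p -` T) ` A"
  have "\<Union>?v = C \<inter> p -` T"
  proof (intro equalityI subsetI)
    fix x assume "x \<in> C \<inter> p -` T"
    then show "x \<in> \<Union>?v" by (fastforce simp: T_def K_def)
  qed (use B in auto)
  moreover have "openin (top_of_set C) u" if u: "u \<in> ?v" for u
  proof -
    obtain w where w: "w \<in> A" "u = B w \<inter> p -` T" using u by blast
    have "open (B w \<inter> p -` T)"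
      by (rule continuous_open_preimage[OF continuous_on_subset[OF cont]])
         (use w B \<open>open T\<close> in auto)
    then show ?thesis using w B C by (auto simp: openin_open_eq)
  qed
  moreover have "pairwise disjnt ?v"
  proof (rule pairwiseI)
    fix u u' assume "u \<in> ?v" "u' \<in> ?v" "u \<noteq> u'"
    then obtain w w' where "w \<in> A" "w' \<in> A" "w \<noteq> w'" "u \<subseteq> B w" "u' \<subseteq> B w'" by blast
    then show "disjnt u u'" using B_disj[of w w'] by (auto simp: disjnt_def)
  qed
  moreover have "\<exists>q. homeomorphism u T p q" if u: "u \<in> ?v" for u
  proof -
    obtain w where w: "w \<in> A" "u = B w \<inter> p -` T" using u by blast
    obtain q where q: "q holomorphic_on (p ` B w)" "\<And>z. z \<in> B w \<Longrightarrow> q (p z) = z"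
      using holomorphic_has_inverse[OF holomorphic_on_subset[OF hol B(3)] B(1) B(4)] w(1) by metis
    have TB: "T \<subseteq> p ` B w" using \<open>T \<subseteq> W\<close> w by (auto simp: W_def)
    have "homeomorphism u T p q"
    proof (rule homeomorphismI)
      show "continuous_on u p" using w B(3) by (intro continuous_on_subset[OF cont]) blast
      show "continuous_on T q"
        using holomorphic_on_imp_continuous_on[OF q(1)] TB by (rule continuous_on_subset)
      show "p ` u \<subseteq> T" using w by auto
      show "q ` T \<subseteq> u" using TB q(2) w by fastforce
      show "q (p x) = x" if "x \<in> u" for x using that w q by auto
      show "p (q z) = z" if "z \<in> T" for z using that TB q(2) by fastforce
    qed
    then show ?thesis by blast
  qed
  moreover have "openin (top_of_set S) T"
    using \<open>open T\<close> \<open>T \<subseteq> W\<close> S by (auto simp: openin_open_eq W_def)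
  ultimately show "\<exists>T. y \<in> T \<and> openin (top_of_set S) T \<and>
      (\<exists>v. \<Union>v = C \<inter> p -` T \<and> (\<forall>u\<in>v. openin (top_of_set C) u) \<and>
        pairwise disjnt v \<and> (\<forall>u\<in>v. \<exists>q. homeomorphism u T p q))"
    using \<open>y \<in> T\<close> by (intro exI[of _ T] conjI exI[of _ ?v] ballI) simp_all
qed

section \<open>Moments from a Pick function\<close>

text \<open>Normalised, the densities give probability measures on one compact interval, which are
  tight. Helly's theorem yields a weak limit along a subsequence, and on a compact interval powers
  act as bounded continuous test functions.\<close>

lemma moment_sequence_limit_densities:
  fixes \<rho> :: "nat \<Rightarrow> real \<Rightarrow> real" and s :: "nat \<Rightarrow> real"
  assumes ab: "a < b"
    and cont: "\<And>k. continuous_on {a..b} (\<rho> k)"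
    and nonneg: "\<And>k x. x \<in> {a..b} \<Longrightarrow> 0 \<le> \<rho> k x"
    and lim: "\<And>n. (\<lambda>k. integral {a..b} (\<lambda>x. \<rho> k x * x ^ n)) \<longlonglongrightarrow> s n"
    and s0: "s 0 = 1"
  shows "\<exists>\<mu>. real_distribution \<mu> \<and> (\<forall>n. integrable \<mu> (\<lambda>x. x ^ n) \<and> s n = (\<integral>x. x ^ n \<partial>\<mu>))"
proof -
  define m where "m = (\<lambda>k. integral {a..b} (\<rho> k))"
  have "m \<longlonglongrightarrow> 1" using lim[of 0] s0 by (simp add: m_def)
  then have "\<forall>\<^sub>F k in sequentially. 0 < m k" by (rule order_tendstoD) simp
  \<comment> \<open>Normalising divides by the mass, which is known to be positive only from
    \<open>N\<close> on; hence the shift by \<open>N\<close> below.\<close>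
  then obtain N where N: "\<And>k. k \<ge> N \<Longrightarrow> 0 < m k" by (auto simp: eventually_sequentially)
  define d where "d k x = indicator {a..b} x * (\<rho> (k + N) x / m (k + N))" for k x
  define M where "M k = density lborel (\<lambda>x. ennreal (d k x))" for k
  \<comment> \<open>Truncation makes \<open>c x ^ n\<close> bounded and continuous on the whole
    line, as weak convergence requires, without changing integrals against
    \<open>M k\<close>.\<close>
  define c where "c x = max a (min b x)" for x :: real
  have c_bounds: "c x \<in> {a..b}" for x using ab by (auto simp: c_def)
  have c_id: "c x = x" if "x \<in> {a..b}" for x using that by (auto simp: c_def)
  have c_cont: "continuous_on UNIV c" unfolding c_def by (intro continuous_intros)
  have c_meas [measurable]: "c \<in> borel_measurable borel"
    using c_cont by (rule borel_measurable_continuous_onI)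
  have d_nonneg: "0 \<le> d k x" for k x
    using N[of "k + N"] nonneg by (auto simp: d_def indicator_def)
  have cont': "continuous_on {a..b} (\<lambda>x. \<rho> (k + N) x / m (k + N) * x ^ n)" for k n
    by (intro continuous_intros cont) (use N[of "k + N"] in auto)
  have lebesgue: "integrable lborel (\<lambda>x. d k x * x ^ n)"
      "(\<integral>x. d k x * x ^ n \<partial>lborel) = integral {a..b} (\<lambda>x. \<rho> (k + N) x * x ^ n) / m (k + N)" for k n
  proof -
    note S = borel_integrable_atLeastAtMost'[OF cont'[of k n]]
    show "integrable lborel (\<lambda>x. d k x * x ^ n)"
      using S by (simp add: set_integrable_def d_def mult_ac)
    have "(\<integral>x. d k x * x ^ n \<partial>lborel) = integral {a..b} (\<lambda>x. \<rho> (k + N) x / m (k + N) * x ^ n)"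
      using set_borel_integral_eq_integral(2)[OF S]
      by (simp add: set_lebesgue_integral_def d_def mult_ac)
    also have "\<dots> = integral {a..b} (\<lambda>x. \<rho> (k + N) x * x ^ n / m (k + N))" by simp
    finally show "(\<integral>x. d k x * x ^ n \<partial>lborel) = integral {a..b} (\<lambda>x. \<rho> (k + N) x * x ^ n) / m (k + N)"
      by simp
  qed
  have d_int: "integrable lborel (d k)" "(\<integral>x. d k x \<partial>lborel) = 1" for k
    using lebesgue[of k 0] N[of "k + N"] by (simp_all add: m_def)
  have [measurable]: "d k \<in> borel_measurable borel" for k
    using d_int(1)[of k] by (auto dest: borel_measurable_integrable)
  have dist: "real_distribution (M k)" for k
  proof -
    have "emeasure (M k) (space (M k)) = (\<integral>\<^sup>+x. ennreal (d k x) \<partial>lborel)"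
      by (simp add: M_def emeasure_density)
    also have "\<dots> = 1"
      using nn_integral_eq_integral[OF d_int(1)[of k]] d_int(2)[of k] d_nonneg by simp
    finally have "prob_space (M k)" by (rule prob_spaceI)
    then show ?thesis by (auto simp: real_distribution_def real_distribution_axioms_def M_def)
  qed
  \<comment> \<open>Tightness is phrased with half-open intervals; the left end \<open>a - 1\<close>
    keeps \<open>a\<close> inside.\<close>
  have supp: "measure (M k) {a - 1<..b} = 1" for k
  proof -
    interpret real_distribution "M k" by (rule dist)
    have "AE x in M k. x \<in> {a - 1<..b}"
    proof -
      have "x \<in> {a - 1<..b}" if "0 < d k x" for x
        using that by (cases "x \<in> {a..b}") (auto simp: d_def)
      then show ?thesis unfolding M_def by (subst AE_density) auto
    qed
    then show ?thesis by (intro prob_eq_1[THEN iffD2]) auto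
  qed
  have "tight M"
    unfolding tight_def
  proof (intro conjI allI impI exI)
    show "a - 1 < b" using ab by simp
  qed (use dist supp in auto)
  from tight_imp_convergent_subsubsequence[OF this strict_mono_id]
  obtain r \<nu> where r: "strict_mono r" and \<nu>: "real_distribution \<nu>" and conv: "weak_conv_m (M \<circ> r) \<nu>"
    by (auto simp: o_def)
  interpret \<nu>: real_distribution \<nu> by (rule \<nu>)
  define B where "B = max \<bar>a\<bar> \<bar>b\<bar>"
  have c_abs: "\<bar>c x\<bar> \<le> B" for x using c_bounds[of x] by (auto simp: B_def)
  have moment: "(\<integral>x. c x ^ n \<partial>\<nu>) = s n" for n
  proof (rule LIMSEQ_unique)
    have "isCont (\<lambda>x. c x ^ n) x" for x
      using c_cont by (intro continuous_intros) (simp add: continuous_on_eq_continuous_at)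
    moreover have "norm (c x ^ n) \<le> B ^ n" for x
      by (simp add: power_abs power_mono c_abs)
    ultimately show "(\<lambda>k. \<integral>x. c x ^ n \<partial>(M \<circ> r) k) \<longlonglongrightarrow> (\<integral>x. c x ^ n \<partial>\<nu>)"
      using weak_conv_imp_integral_bdd_continuous_conv[of "M \<circ> r" \<nu> "\<lambda>x. c x ^ n" "B ^ n"]
        dist \<nu> conv by auto
    have "(\<integral>x. c x ^ n \<partial>M k) = integral {a..b} (\<lambda>x. \<rho> (k + N) x * x ^ n) / m (k + N)" for k
    proof -
      have "(\<integral>x. c x ^ n \<partial>M k) = (\<integral>x. d k x * c x ^ n \<partial>lborel)"
        unfolding M_def by (subst integral_density) (auto simp: d_nonneg)
      also have "\<dots> = (\<integral>x. d k x * x ^ n \<partial>lborel)"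
        by (intro Bochner_Integration.integral_cong) (auto simp: d_def indicator_def c_id)
      finally show ?thesis by (simp add: lebesgue)
    qed
    moreover have "(\<lambda>k. integral {a..b} (\<lambda>x. \<rho> (k + N) x * x ^ n) / m (k + N)) \<longlonglongrightarrow> s n / 1"
      by (intro tendsto_intros LIMSEQ_ignore_initial_segment[OF lim]
          LIMSEQ_ignore_initial_segment[OF \<open>m \<longlonglongrightarrow> 1\<close>]) simp
    ultimately have "(\<lambda>k. \<integral>x. c x ^ n \<partial>M k) \<longlonglongrightarrow> s n" by simp
    from LIMSEQ_subseq_LIMSEQ[OF this r]
    show "(\<lambda>k. \<integral>x. c x ^ n \<partial>(M \<circ> r) k) \<longlonglongrightarrow> s n" by (simp add: o_def)
  qed
  \<comment> \<open>Pushing \<open>\<nu>\<close> forward along the truncation \<open>c\<close> makes its support bounded, so that the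
     moments exist, without having to show that \<open>\<nu>\<close> itself lives on \<open>[a, b]\<close>.\<close>
  have "real_distribution (distr \<nu> borel c)" by simp
  moreover have "integrable (distr \<nu> borel c) (\<lambda>x. x ^ n)" for n
    by (subst integrable_distr_eq)
       (auto intro!: \<nu>.integrable_const_bound[of _ "B ^ n"] simp: power_abs power_mono c_abs)
  moreover have "s n = (\<integral>x. x ^ n \<partial>distr \<nu> borel c)" for n
    by (subst integral_distr) (auto simp: moment)
  ultimately show ?thesis by blast
qed

text \<open>The arc runs from \<open>- R\<close> to \<open>R\<close> through the lower half-plane.
  For \<open>k = Suc n\<close> the integrand is \<open>1 / z\<close>, with integral
  \<open>\<i> * pi\<close>; otherwise it has a primitive that is real at both ends.\<close>

lemma arc_integral_monomial:
  fixes R :: real and k n :: nat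
  assumes "0 < R"
  obtains I where "((\<lambda>z. (1 / z) ^ k * z ^ n) has_contour_integral I) (part_circlepath 0 R (- pi) 0)"
    and "Im I = (if k = Suc n then pi else 0)"
proof (cases "k = Suc n")
  case True
  have "((\<lambda>t. (1 / (0 + of_real R * cis t)) ^ k * (0 + of_real R * cis t) ^ n * of_real R * \<i> * cis t)
          has_integral (\<i> * of_real pi)) {- pi..0}"
    using has_integral_const_real[of "\<i>" "- pi" 0] assms
    by (rule_tac has_integral_eq[rotated]) (auto simp: True field_simps scaleR_conv_of_real)
  then have "((\<lambda>z. (1 / z) ^ k * z ^ n) has_contour_integral (\<i> * of_real pi)) (part_circlepath 0 R (- pi) 0)"
    by (subst has_contour_integral_part_circlepath_iff) simp_all
  then show ?thesis using that True by auto
next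
  case False
  define j where "j = int n - int k + 1"
  have j: "j \<noteq> 0" using False by (auto simp: j_def)
  have eq: "(1 / z) ^ k * z ^ n = of_int j * z powi (j - 1) / of_int j" if "z \<noteq> 0" for z :: complex
  proof -
    have "z powi (j - 1) = z ^ n / z ^ k"
      using that by (simp add: j_def power_int_diff)
    then show ?thesis using j by (simp add: power_divide)
  qed
  have "((\<lambda>z. (1 / z) ^ k * z ^ n) has_contour_integral
      (of_real R powi j / of_int j - of_real (- R) powi j / of_int j)) (part_circlepath 0 R (- pi) 0)"
  proof -
    let ?c = "part_circlepath 0 R (- pi) 0"
    have "((\<lambda>z. (1 / z) ^ k * z ^ n) has_contour_integral
      (pathfinish ?c powi j / of_int j - pathstart ?c powi j / of_int j)) ?c"
    proof (rule contour_integral_primitive[where S = "- {0}"])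
      show "((\<lambda>z. z powi j / of_int j) has_field_derivative (1 / z) ^ k * z ^ n) (at z within - {0})"
        if "z \<in> - {0}" for z :: complex
        using that by (subst eq) (auto intro!: derivative_eq_intros)
      show "path_image ?c \<subseteq> - {0}"
        using in_path_image_part_circlepath[of 0 0 R "- pi" 0] assms by auto
    qed simp
    then show ?thesis by (simp add: exp_minus)
  qed
  moreover have "of_real R powi j / of_int j - of_real (- R) powi j / of_int j
      = complex_of_real (R powi j / of_int j - (- R) powi j / of_int j)"
    by (simp only: of_real_diff of_real_divide of_real_power_int of_real_of_int_eq)
  then have "Im (of_real R powi j / of_int j - of_real (- R) powi j / of_int j) = 0"
    by (simp only: Im_complex_of_real)
  ultimately show ?thesis using that False by auto
qed

text \<open>The series converges uniformly on the arc and is integrated termwise. As the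
  \<open>a k\<close> are real, only the term with \<open>1 / z\<close> contributes an imaginary
  part.\<close>

lemma Im_arc_integral_power_series:
  fixes a :: "nat \<Rightarrow> real" and h :: "complex \<Rightarrow> complex"
  assumes R: "0 < R" and summable: "summable (\<lambda>k. \<bar>a k\<bar> * (1 / R) ^ k)"
    and sums: "\<And>u. norm u = 1 / R \<Longrightarrow> (\<lambda>k. of_real (a k) * u ^ k) sums h u"
  shows "Im (contour_integral (part_circlepath 0 R (- pi) 0) (\<lambda>z. h (1 / z) * z ^ n)) = pi * a (Suc n)"
proof -
  let ?c = "part_circlepath 0 R (- pi) 0"
  define f where "f N z = (\<Sum>k<N. of_real (a k) * ((1 / z) ^ k * z ^ n))" for N and z :: complex
  have "\<exists>I. ((\<lambda>z. (1 / z) ^ k * z ^ n) has_contour_integral I) ?c \<and> Im I = (if k = Suc n then pi else 0)" for k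
    using arc_integral_monomial[OF R] by metis
  then obtain I where I: "\<And>k. ((\<lambda>z. (1 / z) ^ k * z ^ n) has_contour_integral I k) ?c"
      "\<And>k. Im (I k) = (if k = Suc n then pi else 0)"
    by metis
  have fI: "(f N has_contour_integral (\<Sum>k<N. of_real (a k) * I k)) ?c" for N
    unfolding f_def by (intro has_contour_integral_sum has_contour_integral_lmul I) auto
  have unif: "uniform_limit (path_image ?c) f (\<lambda>z. h (1 / z) * z ^ n) sequentially"
  proof -
    have norm: "norm z = R" if "z \<in> path_image ?c" for z
      using in_path_image_part_circlepath[OF that] R by simp
    have "uniform_limit (path_image ?c) (\<lambda>N z. \<Sum>k<N. of_real (a k) * ((1 / z) ^ k * z ^ n))
        (\<lambda>z. suminf (\<lambda>k. of_real (a k) * ((1 / z) ^ k * z ^ n))) sequentially"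
    proof (rule Weierstrass_m_test)
      show "norm (of_real (a k) * ((1 / z) ^ k * z ^ n)) \<le> \<bar>a k\<bar> * (1 / R) ^ k * R ^ n"
        if "z \<in> path_image ?c" for k z
        using norm[OF that] by (simp add: norm_mult norm_power norm_divide)
    qed (use summable in \<open>rule summable_mult2\<close>)
    moreover have "suminf (\<lambda>k. of_real (a k) * ((1 / z) ^ k * z ^ n)) = h (1 / z) * z ^ n"
      if "z \<in> path_image ?c" for z
      using sums_mult2[OF sums, of "1 / z" "z ^ n"] norm[OF that]
      by (intro sums_unique[symmetric]) (simp add: norm_divide mult.assoc)
    ultimately show ?thesis
      unfolding f_def by (subst (asm) uniform_limit_cong') auto
  qed
  \<comment> \<open>The bound \<open>R * pi\<close> is the constant speed of the arc, parametrised
    over the unit interval.\<close>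
  have "(\<lambda>N. contour_integral ?c (f N)) \<longlonglongrightarrow> contour_integral ?c (\<lambda>z. h (1 / z) * z ^ n)"
    by (rule contour_integral_uniform_limit(2)[OF _ unif, where B = "R * pi"])
       (use fI R in \<open>auto intro!: always_eventually simp: contour_integrable_on_def vector_derivative_part_circlepath norm_mult\<close>)
  then have "(\<lambda>N. Im (contour_integral ?c (f N))) \<longlonglongrightarrow> Im (contour_integral ?c (\<lambda>z. h (1 / z) * z ^ n))"
    by (rule tendsto_Im)
  \<comment> \<open>From \<open>n + 2\<close> on, the range \<open>k < N\<close> contains the index
    \<open>Suc n\<close>.\<close>
  moreover have "Im (contour_integral ?c (f N)) = pi * a (Suc n)" if "N \<ge> n + 2" for N
  proof -
    have "Im (contour_integral ?c (f N)) = (\<Sum>k<N. a k * (if k = Suc n then pi else 0))"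
      by (simp add: contour_integral_unique[OF fI] I(2))
    also have "\<dots> = (\<Sum>k<N. if k = Suc n then pi * a (Suc n) else 0)"
      by (intro sum.cong) auto
    also have "\<dots> = pi * a (Suc n)" using that by simp
    finally show ?thesis .
  qed
  then have "(\<lambda>N. Im (contour_integral ?c (f N))) \<longlonglongrightarrow> pi * a (Suc n)"
    by (intro tendsto_eventually) (auto simp: eventually_sequentially)
  ultimately show ?thesis using LIMSEQ_unique by blast
qed

text \<open>This is a Stieltjes inversion: \<open>1 / z\<close> maps the lower half-plane to the
  upper one, so the boundary values of \<open>Im (g (1 / z)) / pi\<close> ought to be a density.
  They need not exist, so the shift by \<open>\<epsilon> k\<close> replaces them by continuous
  densities.\<close>

lemma moment_sequence_Pick_function:
  fixes g h :: "complex \<Rightarrow> complex" and a :: "nat \<Rightarrow> real"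
  assumes g: "g holomorphic_on {z. Im z > 0}" and pos: "\<And>z. Im z > 0 \<Longrightarrow> Im (g z) \<ge> 0"
    and r: "r > 0" and sums: "\<And>z. norm z < r \<Longrightarrow> (\<lambda>n. of_real (a n) * z ^ n) sums h z"
    and gh: "\<And>z. \<lbrakk>Im z > 0; norm z < r\<rbrakk> \<Longrightarrow> g z = h z"
    and a1: "a (Suc 0) = 1"
  shows "\<exists>\<mu>. real_distribution \<mu> \<and>
           (\<forall>n. integrable \<mu> (\<lambda>x. x ^ n) \<and> a (Suc n) = (\<integral>x. x ^ n \<partial>\<mu>))"
proof -
  \<comment> \<open>On the arc \<open>1 / z\<close> then has norm \<open>r / 2\<close>, inside the
    disc of convergence.\<close>
  define R where "R = 2 / r"
  define \<epsilon> where "\<epsilon> = (\<lambda>k. 1 / real (Suc k))"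
  define G where "G = (\<lambda>k z. g (1 / (z - \<i> * of_real (\<epsilon> k))))"
  let ?c = "part_circlepath 0 R (- pi) 0"
  have R: "R > 0" "1 / R < r" using r by (auto simp: R_def)
  have \<epsilon>: "0 < \<epsilon> k" "\<epsilon> k \<le> 1" for k by (auto simp: \<epsilon>_def)
  have hol_h: "h holomorphic_on ball 0 r"
    by (rule power_series_holomorphic[of _ _ "\<lambda>n. of_real (a n)"]) (use sums in simp)
  have Im_inv: "Im (1 / z) > 0" if "Im z < 0" for z
  proof -
    have "z \<noteq> 0" using that by auto
    then have "0 < (Re z)\<^sup>2 + (Im z)\<^sup>2" by (simp add: complex_neq_0)
    then show ?thesis using that by (simp add: Im_divide divide_neg_pos)
  qed
  have hol_G: "G k holomorphic_on {z. Im z < \<epsilon> k}" for k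
  proof -
    have "(g \<circ> (\<lambda>z. 1 / (z - \<i> * of_real (\<epsilon> k)))) holomorphic_on {z. Im z < \<epsilon> k}"
    proof (rule holomorphic_on_compose_gen[OF _ g])
      show "(\<lambda>z. 1 / (z - \<i> * of_real (\<epsilon> k))) holomorphic_on {z. Im z < \<epsilon> k}"
        by (intro holomorphic_intros) auto
      show "(\<lambda>z. 1 / (z - \<i> * of_real (\<epsilon> k))) ` {z. Im z < \<epsilon> k} \<subseteq> {z. 0 < Im z}"
        by (auto intro!: Im_inv)
    qed
    then show ?thesis by (simp add: G_def o_def)
  qed
  have arc: "norm z = R" "Im z \<le> 0" if z: "z \<in> path_image ?c" for z
  proof -
    show "norm z = R" using in_path_image_part_circlepath[OF z] R by simp
    obtain t where t: "t \<in> {-pi..0}" "z = R * cis t"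
      using z by (auto simp: path_image_part_circlepath' closed_segment_eq_real_ivl)
    have "0 \<le> sin (- t)" by (rule sin_ge_zero) (use t in auto)
    then show "Im z \<le> 0" using t R by (auto simp: mult_le_0_iff)
  qed
  have ends: "pathstart ?c = of_real (- R)" "pathfinish ?c = of_real R"
    by (simp_all add: exp_minus)
  have line: "Im z = 0" if "z \<in> closed_segment (of_real (- R)) (of_real R)" for z
    using that by (auto simp: closed_segment_def)
  \<comment> \<open>Arc and segment form a closed path in the convex half-plane
    \<open>Im z < \<epsilon> k\<close>, where \<open>G k\<close> is holomorphic, so Cauchy's theorem
    equates the integrals. Powers of real \<open>x\<close> pass through \<open>Im\<close>.\<close>
  have segment: "integral {- R..R} (\<lambda>x. Im (G k (of_real x)) * x ^ n)
      = Im (contour_integral ?c (\<lambda>z. G k z * z ^ n))" for k n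
  proof -
    let ?f = "\<lambda>z. G k z * z ^ n"
    have hol: "?f holomorphic_on {z. Im z < \<epsilon> k}"
      by (intro holomorphic_intros hol_G)
    note cont = holomorphic_on_imp_continuous_on[OF hol]
    have sub: "path_image ?c \<subseteq> {z. Im z < \<epsilon> k}"
        "closed_segment (of_real (- R)) (of_real R) \<subseteq> {z. Im z < \<epsilon> k}"
      using arc(2) line \<epsilon>(1)[of k] by fastforce+
    have "(?f has_contour_integral 0) (?c +++ linepath (of_real R) (of_real (- R)))"
    proof (rule Cauchy_theorem_convex_simple[OF hol])
      show "convex {z. Im z < \<epsilon> k}" by (rule convex_halfspace_Im_lt)
      show "path_image (?c +++ linepath (of_real R) (of_real (- R))) \<subseteq> {z. Im z < \<epsilon> k}"
        using sub by (subst path_image_join) (simp_all only: ends pathstart_linepath, auto simp: closed_segment_commute)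
    qed (simp_all only: ends valid_path_join valid_path_part_circlepath valid_path_linepath
        pathstart_join pathfinish_join pathstart_linepath pathfinish_linepath)
    then have "contour_integral ?c ?f + contour_integral (linepath (of_real R) (of_real (- R))) ?f = 0"
    proof -
      have "?f contour_integrable_on ?c"
        by (intro contour_integrable_continuous_part_circlepath continuous_on_subset[OF cont sub(1)])
      moreover have "?f contour_integrable_on linepath (of_real R) (of_real (- R))"
        by (intro contour_integrable_continuous_linepath continuous_on_subset[OF cont])
           (use sub(2) in \<open>simp add: closed_segment_commute\<close>)
      ultimately have "contour_integral (?c +++ linepath (of_real R) (of_real (- R))) ?f
          = contour_integral ?c ?f + contour_integral (linepath (of_real R) (of_real (- R))) ?f"
        by (rule contour_integral_join) simp_all
      then show ?thesis
        using contour_integral_unique[OF \<open>(?f has_contour_integral 0) _\<close>] by simp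
    qed
    moreover have "contour_integral (linepath (of_real (- R)) (of_real R)) ?f
        = - contour_integral (linepath (of_real R) (of_real (- R))) ?f"
      by (rule contour_integral_reverse_linepath[OF continuous_on_subset[OF cont sub(2)]])
    ultimately have "contour_integral ?c ?f = contour_integral (linepath (of_real (- R)) (of_real R)) ?f"
      by (metis eq_neg_iff_add_eq_0)
    also have "\<dots> = integral {- R..R} (\<lambda>x. ?f (of_real x))"
      using R by (subst contour_integral_linepath_Reals_eq) (auto simp del: of_real_minus)
    finally have eq: "contour_integral ?c ?f = integral {- R..R} (\<lambda>x. ?f (of_real x))" .
    have int: "(\<lambda>x. ?f (complex_of_real x)) integrable_on {- R..R}"
      by (intro integrable_continuous_interval continuous_on_compose2[OF cont] continuous_intros)
         (use \<epsilon> in auto)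
    have "((\<lambda>x. Im (?f (complex_of_real x))) has_integral Im (contour_integral ?c ?f)) {- R..R}"
      unfolding eq using has_integral_linear[OF integrable_integral[OF int] bounded_linear_Im] by (simp add: o_def)
    moreover have "Im (?f (complex_of_real x)) = Im (G k (of_real x)) * x ^ n" for x
      by (simp flip: of_real_power)
    ultimately show ?thesis by (simp add: integral_unique)
  qed
  have lim: "(\<lambda>k. contour_integral ?c (\<lambda>z. G k z * z ^ n))
      \<longlonglongrightarrow> contour_integral ?c (\<lambda>z. h (1 / z) * z ^ n)" for n
  proof (rule contour_integral_uniform_limit(2)[where B = "R * pi"])
    have "continuous_on (path_image ?c) (\<lambda>z. G k z * z ^ n)" for k
      by (intro continuous_intros continuous_on_subset[OF holomorphic_on_imp_continuous_on[OF hol_G]])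
         (use arc(2) \<epsilon>(1)[of k] in fastforce)
    then show "\<forall>\<^sub>F k in sequentially. (\<lambda>z. G k z * z ^ n) contour_integrable_on ?c"
      by (intro always_eventually allI contour_integrable_continuous_part_circlepath)
    \<comment> \<open>Moving a point of the arc down by \<open>\<epsilon> k\<close> does not
      decrease its norm, as \<open>Im z \<le> 0\<close>, and increases it by at most 1. Uniform
      continuity of \<open>h (1 / z)\<close> on this annulus gives the uniform limit.\<close>
    define A where "A = {z :: complex. R \<le> norm z \<and> norm z \<le> R + 1}"
    have "A = cball 0 (R + 1) - ball 0 R" by (auto simp: A_def)
    then have "compact A" by (simp add: compact_diff)
    have A_inv: "z \<noteq> 0" "norm (1 / z) < r" if "z \<in> A" for z
    proof -
      show "z \<noteq> 0" using that R by (auto simp: A_def)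
      have "norm (1 / z) \<le> 1 / R" using that R by (auto simp: A_def norm_divide frac_le)
      then show "norm (1 / z) < r" using R by simp
    qed
    have cont_h: "continuous_on A (\<lambda>z. h (1 / z))"
      by (intro continuous_on_compose2[OF holomorphic_on_imp_continuous_on[OF hol_h]] continuous_intros)
         (use A_inv in auto)
    have ucont: "uniformly_continuous_on A (\<lambda>z. h (1 / z))"
      using cont_h \<open>compact A\<close> by (rule compact_uniformly_continuous)
    have shift: "z - \<i> * of_real (\<epsilon> k) \<in> A" "z \<in> A" if "z \<in> path_image ?c" for z k
    proof -
      show "z \<in> A" using arc(1)[OF that] by (auto simp: A_def)
      have "norm (z - \<i> * of_real (\<epsilon> k)) \<le> norm z + \<epsilon> k"
        using norm_triangle_ineq4[of z "\<i> * of_real (\<epsilon> k)"] \<epsilon>(1)[of k] by (simp add: norm_mult)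
      moreover have "norm z \<le> norm (z - \<i> * of_real (\<epsilon> k))"
      proof -
        have "(Im z)\<^sup>2 \<le> (Im z - \<epsilon> k)\<^sup>2"
          using arc(2)[OF that] \<epsilon>(1)[of k] by (simp flip: abs_le_square_iff)
        then show ?thesis by (simp add: norm_complex_def)
      qed
      ultimately show "z - \<i> * of_real (\<epsilon> k) \<in> A"
        using arc(1)[OF that] \<epsilon>(2)[of k] by (auto simp: A_def)
    qed
    have G_eq: "G k z = h (1 / (z - \<i> * of_real (\<epsilon> k)))" if "z \<in> path_image ?c" for k z
      unfolding G_def using A_inv(2)[OF shift(1)[OF that]] arc(2)[OF that] \<epsilon>(1)[of k]
      by (intro gh Im_inv) auto
    have "uniform_limit (path_image ?c) G (\<lambda>z. h (1 / z)) sequentially"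
    proof (rule uniform_limitI)
      fix e :: real assume "e > 0"
      then obtain d where d: "d > 0" "\<And>z w. \<lbrakk>z \<in> A; w \<in> A; dist w z < d\<rbrakk> \<Longrightarrow> dist (h (1 / w)) (h (1 / z)) < e"
        using ucont unfolding uniformly_continuous_on_def by metis
      have "\<epsilon> \<longlonglongrightarrow> 0" unfolding \<epsilon>_def by (rule LIMSEQ_Suc[OF lim_1_over_n])
      then have "\<forall>\<^sub>F k in sequentially. \<epsilon> k < d" using d(1) by (rule order_tendstoD)
      then show "\<forall>\<^sub>F k in sequentially. \<forall>z\<in>path_image ?c. dist (G k z) (h (1 / z)) < e"
      proof (rule eventually_mono, safe)
        fix k z assume "\<epsilon> k < d" and z: "z \<in> path_image ?c"
        then show "dist (G k z) (h (1 / z)) < e"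
          unfolding G_eq[OF z] using \<epsilon>(1)[of k]
          by (intro d(2) shift) (auto simp: dist_norm norm_mult)
      qed
    qed
    then show "uniform_limit (path_image ?c) (\<lambda>k z. G k z * z ^ n) (\<lambda>z. h (1 / z) * z ^ n) sequentially"
    proof (rule uniform_lim_mult[OF _ uniform_limit_const])
      have "compact (path_image ?c)" by (simp add: compact_path_image)
      moreover have "continuous_on (path_image ?c) (\<lambda>z. h (1 / z))"
        using cont_h by (rule continuous_on_subset) (use shift in blast)
      ultimately show "bounded ((\<lambda>z. h (1 / z)) ` path_image ?c)"
          "bounded ((\<lambda>z. z ^ n) ` path_image ?c)"
        by (auto intro!: compact_imp_bounded compact_continuous_image continuous_intros)
    qed
  qed (use R in \<open>auto simp: vector_derivative_part_circlepath norm_mult\<close>)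
  have val: "Im (contour_integral ?c (\<lambda>z. h (1 / z) * z ^ n)) = pi * a (Suc n)" for n
  proof (rule Im_arc_integral_power_series)
    \<comment> \<open>Convergence at the larger radius \<open>\<rho>\<close> gives absolute
      convergence at \<open>1 / R\<close>.\<close>
    obtain \<rho> where \<rho>: "1 / R < \<rho>" "\<rho> < r" using R dense by blast
    have "\<rho> > 0" using \<rho>(1) R(1) by (meson divide_pos_pos less_trans zero_less_one)
    then have "summable (\<lambda>k. of_real (a k) * of_real \<rho> ^ k :: complex)"
      using sums[of "of_real \<rho>"] \<rho> by (auto simp: sums_iff)
    from powser_insidea[OF this, of "of_real (1 / R)"]
    show "summable (\<lambda>k. \<bar>a k\<bar> * (1 / R) ^ k)"
      using \<rho> R \<open>\<rho> > 0\<close> by (simp add: norm_mult norm_power norm_divide power_divide)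
  qed (use R sums in auto)
  show ?thesis
  proof (rule moment_sequence_limit_densities[where a = "- R" and b = R])
    \<comment> \<open>Dividing by \<open>pi\<close> cancels the factor from the arc
      integral.\<close>
    let ?\<rho> = "\<lambda>k x. Im (G k (complex_of_real x)) / pi"
    show "continuous_on {- R..R} (?\<rho> k)" for k
      by (intro continuous_intros continuous_on_compose2[OF holomorphic_on_imp_continuous_on[OF hol_G]])
         (use \<epsilon> in auto)
    show "0 \<le> ?\<rho> k x" for k x
      unfolding G_def using \<epsilon>(1)[of k] by (intro divide_nonneg_pos pos Im_inv) auto
    have "(\<lambda>k. Im (contour_integral ?c (\<lambda>z. G k z * z ^ n)) / pi) \<longlonglongrightarrow> pi * a (Suc n) / pi" for n
      unfolding val[symmetric] by (intro tendsto_intros lim) simp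
    moreover have "integral {- R..R} (\<lambda>x. ?\<rho> k x * x ^ n)
        = Im (contour_integral ?c (\<lambda>z. G k z * z ^ n)) / pi" for k n
      unfolding segment[symmetric] by (simp flip: integral_divide)
    ultimately show "(\<lambda>k. integral {- R..R} (\<lambda>x. ?\<rho> k x * x ^ n)) \<longlonglongrightarrow> a (Suc n)" for n
      by simp
  qed (use R a1 in auto)
qed

section \<open>Inverting a rational function on the upper half-plane\<close>

text \<open>Exponents above the degree are allowed so that numerator and denominator can be scaled
  by the same power.\<close>

lemma poly_over_power_tendsto:
  fixes p :: "'a::real_normed_field poly"
  assumes "degree p \<le> n"
  shows "((\<lambda>w. poly p w / w ^ n) \<longlongrightarrow> coeff p n) at_infinity"
proof -
  define k where "k = n - degree p"
  have n: "n = degree p + k" using assms by (simp add: k_def)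
  have inv: "((\<lambda>w :: 'a. inverse w ^ k) \<longlongrightarrow> 0 ^ k) at_infinity"
    by (intro tendsto_power tendsto_inverse_0)
  have "((\<lambda>w. poly p w / w ^ degree p * inverse w ^ k) \<longlongrightarrow> lead_coeff p * 0 ^ k) at_infinity"
    by (intro tendsto_mult poly_divide_tendsto_aux inv)
  \<comment> \<open>For \<open>k = 0\<close> this rests on \<open>0 ^ 0 = 1\<close>; for larger
    \<open>k\<close> both sides vanish.\<close>
  moreover have "lead_coeff p * 0 ^ k = coeff p n"
    by (cases k) (auto simp: n coeff_eq_0)
  moreover have "poly p w / w ^ degree p * inverse w ^ k = poly p w / w ^ n" for w
    by (simp add: n power_add power_inverse divide_simps)
  ultimately show ?thesis by simp
qed

section \<open>Real polynomials and power series over the complex numbers\<close>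

lemma map_poly_of_real_mult:
  "map_poly complex_of_real (p * q) = map_poly complex_of_real p * map_poly complex_of_real q"
  by (rule poly_eqI) (simp add: coeff_map_poly coeff_mult)

lemma map_poly_of_real_add:
  "map_poly complex_of_real (p + q) = map_poly complex_of_real p + map_poly complex_of_real q"
  by (rule poly_eqI) (simp add: coeff_map_poly)

lemma poly_map_poly_of_real:
  "poly (map_poly complex_of_real p) (complex_of_real x) = complex_of_real (poly p x)"
  by (induction p) (auto simp: map_poly_pCons)

text \<open>A Bezout identity over the reals persists at complex points.\<close>

lemma coprime_no_common_complex_root:
  fixes p q :: "real poly"
  assumes "coprime p q" "poly (map_poly complex_of_real p) w = 0"
  shows "poly (map_poly complex_of_real q) w \<noteq> 0"
proof
  assume q: "poly (map_poly complex_of_real q) w = 0"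
  obtain x y where "x * p + y * q = 1"
    using bezout_coefficients[of p q] assms(1) by (metis coprime_iff_gcd_eq_1 surj_pair)
  then have "poly (map_poly complex_of_real (x * p + y * q)) w = 1" by simp
  then show False using assms(2) q by (simp add: map_poly_of_real_mult map_poly_of_real_add)
qed

text \<open>\<open>comp_inverse F\<close> is a real series, while holomorphic functions expand into
  complex ones; this embedding makes them comparable.\<close>

definition fps_of_real :: "real fps \<Rightarrow> complex fps" where
  "fps_of_real f = Abs_fps (\<lambda>n. complex_of_real (fps_nth f n))"

lemma fps_of_real_nth [simp]: "fps_nth (fps_of_real f) n = complex_of_real (fps_nth f n)"
  by (simp add: fps_of_real_def)

lemma fps_of_real_1 [simp]: "fps_of_real 1 = 1"
  by (rule fps_ext) simp

lemma fps_of_real_X [simp]: "fps_of_real fps_X = fps_X"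
  by (rule fps_ext) (simp add: fps_X_def)

lemma fps_of_real_mult: "fps_of_real (f * g) = fps_of_real f * fps_of_real g"
  by (rule fps_ext) (simp add: fps_mult_nth)

lemma fps_of_real_power: "fps_of_real (f ^ n) = fps_of_real f ^ n"
  by (induction n) (simp_all add: fps_of_real_mult)

lemma fps_of_real_compose: "fps_of_real (f oo g) = fps_of_real f oo fps_of_real g"
  by (rule fps_ext) (simp add: fps_compose_nth flip: fps_of_real_power)

lemma fps_of_real_fps_of_poly: "fps_of_real (fps_of_poly p) = fps_of_poly (map_poly complex_of_real p)"
  by (rule fps_ext) (simp add: coeff_map_poly)

text \<open>Composing with \<open>fps_inv f\<close> on the left cancels \<open>f\<close>. This
  serves to identify the expansion of a holomorphic local inverse with the formal inverse.\<close>

lemma fps_right_inverse_unique: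
  fixes f g h :: "'a::field fps"
  assumes "fps_nth f 0 = 0" "fps_nth f 1 \<noteq> 0" "fps_nth g 0 = 0" "f oo g = fps_X"
  shows "g = fps_inv f"
proof -
  have "g = (fps_inv f oo f) oo g"
    using assms by (simp add: fps_inv fps_X_fps_compose_startby0)
  also have "\<dots> = fps_inv f oo (f oo g)"
    by (rule fps_compose_assoc[symmetric]) (use assms in auto)
  finally show ?thesis using assms(4) by simp
qed

text \<open>By the intermediate value theorem, a change of sign would produce a zero.\<close>

lemma Im_pos_connected:
  fixes h :: "complex \<Rightarrow> complex"
  assumes "connected S" "continuous_on S h" "\<And>z. z \<in> S \<Longrightarrow> Im (h z) \<noteq> 0"
    and "a \<in> S" "Im (h a) > 0" "z \<in> S"
  shows "Im (h z) > 0"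
proof (rule ccontr)
  assume "\<not> Im (h z) > 0"
  moreover have "connected ((\<lambda>z. Im (h z)) ` S)"
    by (intro connected_continuous_image continuous_intros assms)
  ultimately have "0 \<in> (\<lambda>z. Im (h z)) ` S"
    using assms(4-6) connectedD_interval[of _ "Im (h z)" "Im (h a)" 0] by auto
  then show False using assms(3) by auto
qed

section \<open>The rational function on the complex plane\<close>

locale rational_representation =
  fixes F :: "real poly fract" and P Q :: "real poly"
  assumes rep: "represents F P Q"
begin

definition num :: "complex poly" where "num = [:0, 1:] * map_poly complex_of_real P"
definition den :: "complex poly" where "den = map_poly complex_of_real Q"
definition f :: "complex \<Rightarrow> complex" where "f w = poly num w / poly den w"

lemma level: "level_poly P Q z = num - smult z den"
  by (simp add: level_poly_def num_def den_def)

lemma den_0: "poly den 0 = 1"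
  using rep poly_map_poly_of_real[of Q 0] by (simp add: den_def represents_def)

text \<open>A zero of \<open>num\<close> is either 0, where \<open>den\<close> is 1, or a root of
  \<open>P\<close>, where coprimality applies.\<close>

lemma den_nonzero: "poly num w = 0 \<Longrightarrow> poly den w \<noteq> 0"
  using rep coprime_no_common_complex_root[of P Q w] den_0
  by (auto simp: num_def den_def represents_def)

text \<open>At a pole the equation would make \<open>num\<close> vanish together with
  \<open>den\<close>. Limits can thus be taken in the polynomial equation before the limit point is
  known not to be a pole.\<close>

lemma f_eqI: "poly num w = z * poly den w \<Longrightarrow> f w = z"
  using den_nonzero[of w] by (cases "poly den w = 0") (auto simp: f_def)

text \<open>Real poles are included: there division by zero gives the real value 0.\<close>

lemma Im_f_real: "Im w = 0 \<Longrightarrow> Im (f w) = 0"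
proof -
  assume "Im w = 0"
  then have w: "w = complex_of_real (Re w)" by (simp add: complex_eq_iff)
  have "f w = complex_of_real (Re w * poly P (Re w) / poly Q (Re w))"
    by (subst w) (simp add: f_def num_def den_def poly_map_poly_of_real)
  then show ?thesis by simp
qed

lemma f_holomorphic: "(\<And>w. w \<in> S \<Longrightarrow> poly den w \<noteq> 0) \<Longrightarrow> f holomorphic_on S"
  unfolding f_def by (intro holomorphic_intros) auto


text \<open>The analytic expansion and the formal quotient both yield the series of
  \<open>num\<close> when multiplied by that of \<open>den\<close>, which is nonzero and
  cancels.\<close>

lemma f_fps_expansion: "f has_fps_expansion fps_of_real (taylor F)"
proof -
  have exp_poly: "poly p has_fps_expansion fps_of_poly p" for p :: "complex poly"
    by (simp add: has_fps_expansion_def)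
  have ev: "\<forall>\<^sub>F w in nhds 0. poly den w \<noteq> 0"
    by (rule eventually_nhds_in_open[THEN eventually_mono, of "- {w. poly den w = 0}"])
       (auto simp: den_0 intro!: closed_Collect_eq continuous_intros)
  then obtain S where S: "open S" "0 \<in> S" "\<And>w. w \<in> S \<Longrightarrow> poly den w \<noteq> 0"
    by (auto simp: eventually_nhds)
  then have "f analytic_on {0}"
    using f_holomorphic[of S] by (auto simp: analytic_at)
  then obtain E where E: "f has_fps_expansion E"
    using analytic_at_imp_has_fps_expansion_0 by blast
  have "(\<lambda>w. f w * poly den w) has_fps_expansion E * fps_of_poly den"
    by (intro has_fps_expansion_mult E exp_poly)
  also have "?this \<longleftrightarrow> poly num has_fps_expansion E * fps_of_poly den"
    by (rule has_fps_expansion_cong) (auto intro!: eventually_mono[OF ev] simp: f_def)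
  finally have "E * fps_of_poly den = fps_of_poly num"
    using exp_poly fps_expansion_unique_complex by blast
  moreover have "fps_of_real (taylor F) * fps_of_poly den = fps_of_poly num"
  proof -
    have unit: "is_unit (fps_of_poly Q)"
      using rep by (simp add: represents_def fps_is_unit_iff poly_0_coeff_0)
    have "taylor F * fps_of_poly Q = fps_X * fps_of_poly P"
      unfolding taylor_eq[OF rep] using unit by (simp add: unit_imp_dvd)
    also have "\<dots> = fps_of_poly ([:0, 1:] * P)"
      by (simp add: fps_of_poly_pCons)
    finally have "fps_of_real (taylor F * fps_of_poly Q) = fps_of_real (fps_of_poly ([:0, 1:] * P))"
      by simp
    then show ?thesis
      by (simp only: fps_of_real_mult fps_of_real_fps_of_poly map_poly_of_real_mult den_def num_def)
         (simp add: map_poly_pCons)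
  qed
  ultimately have "E * fps_of_poly den = fps_of_real (taylor F) * fps_of_poly den" by simp
  moreover have "fps_of_poly den \<noteq> 0" using den_0 by auto
  ultimately have "E = fps_of_real (taylor F)" by simp
  with E show ?thesis by simp
qed

text \<open>Convergence of the formal inverse comes from complex analysis:
  \<open>deriv f 0 = 1\<close> gives a holomorphic local inverse \<open>h\<close>, whose expansion
  is a right inverse of the series of \<open>f\<close> and hence the formal one.\<close>

lemma local_inverse:
  obtains r h where "r > 0" "h holomorphic_on ball 0 r"
    "\<And>z. norm z < r \<Longrightarrow> (\<lambda>n. of_real (fps_nth (comp_inverse F) n) * z ^ n) sums h z"
    "\<And>z. norm z < r \<Longrightarrow> f (h z) = z" "h 0 = 0" "deriv h 0 = 1"
proof -
  have F: "F \<in> rat_class" using rep by (auto simp: rat_class_def)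
  note inv = comp_inverse[OF F]
  have t0: "fps_nth (taylor F) 0 = 0"
    using has_fps_expansion_imp_0_eq_fps_nth_0[OF f_fps_expansion] by (simp add: f_def num_def)
  \<comment> \<open>Coefficients of \<open>fps_X\<close> are compared in
    \<open>taylor F oo comp_inverse F = fps_X\<close>.\<close>
  have t1: "fps_nth (taylor F) 1 * s_coeff F 0 = 1"
    using inv(2)[THEN arg_cong[of _ _ "\<lambda>f. fps_nth f 1"]] inv(1)
    by (simp add: fps_compose_nth s_coeff_def)
  have t1: "fps_nth (taylor F) 1 = 1" using t1 inv(3) by simp
  have d1: "deriv f 0 = 1"
    using fps_nth_fps_expansion[OF f_fps_expansion, of 1] t1 by simp
  define S where "S = - {w. poly den w = 0}"
  have S: "open S" "0 \<in> S" "f holomorphic_on S"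
    unfolding S_def by (auto simp: den_0 intro!: f_holomorphic closed_Collect_eq continuous_intros)
  obtain \<rho> where \<rho>: "\<rho> > 0" "ball 0 \<rho> \<subseteq> S" "open (f ` ball 0 \<rho>)" "inj_on f (ball 0 \<rho>)"
    using has_complex_derivative_locally_invertible[OF S(3,2,1)] d1 by auto
  obtain h where h: "h holomorphic_on (f ` ball 0 \<rho>)" "\<And>z. z \<in> ball 0 \<rho> \<Longrightarrow> h (f z) = z"
    using holomorphic_has_inverse[OF holomorphic_on_subset[OF S(3) \<rho>(2)] open_ball \<rho>(4)] by metis
  have f0: "f 0 = 0" by (simp add: f_def num_def)
  then have "0 \<in> f ` ball 0 \<rho>" using \<rho>(1) by (metis centre_in_ball imageI)
  then obtain r where r: "r > 0" "ball 0 r \<subseteq> f ` ball 0 \<rho>" using \<rho>(3) by (meson openE)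
  have hol: "h holomorphic_on ball 0 r" using h(1) r(2) by (rule holomorphic_on_subset)
  have fh: "f (h z) = z" if "norm z < r" for z
  proof -
    have "z \<in> f ` ball 0 \<rho>" using that r(2) by auto
    then show ?thesis using h(2) by auto
  qed
  have "h analytic_on {0}" using hol r(1) by (auto simp: analytic_at intro!: exI[of _ "ball 0 r"])
  then obtain H where H: "h has_fps_expansion H"
    using analytic_at_imp_has_fps_expansion_0 by blast
  have h0: "h 0 = 0" using h(2)[of 0] f0 \<rho>(1) by simp
  then have H0: "fps_nth H 0 = 0"
    using has_fps_expansion_imp_0_eq_fps_nth_0[OF H] by simp
  have "(f \<circ> h) has_fps_expansion (fps_of_real (taylor F) oo H)"
    by (rule has_fps_expansion_compose[OF f_fps_expansion H H0])
  also have "?this \<longleftrightarrow> (\<lambda>z. z) has_fps_expansion (fps_of_real (taylor F) oo H)"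
    by (rule has_fps_expansion_cong)
       (use r(1) fh in \<open>auto simp: eventually_nhds_metric intro!: exI[of _ r]\<close>)
  finally have HX: "fps_of_real (taylor F) oo H = fps_X"
    using has_fps_expansion_fps_X fps_expansion_unique_complex by blast
  have H_eq: "H = fps_of_real (comp_inverse F)"
  proof -
    have 1: "fps_nth (fps_of_real (taylor F)) 0 = 0" "fps_nth (fps_of_real (taylor F)) 1 \<noteq> 0"
      using t0 t1 by simp_all
    have "fps_of_real (taylor F) oo fps_of_real (comp_inverse F) = fps_X"
      using inv(2) by (simp flip: fps_of_real_compose)
    moreover have "fps_nth (fps_of_real (comp_inverse F)) 0 = 0" using inv(1) by simp
    ultimately have "fps_of_real (comp_inverse F) = fps_inv (fps_of_real (taylor F))"
      by (intro fps_right_inverse_unique[OF 1])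
    then show ?thesis using fps_right_inverse_unique[OF 1 H0 HX] by simp
  qed
  then have "(\<lambda>n. of_real (fps_nth (comp_inverse F) n) * z ^ n) sums h z" if "norm z < r" for z
    using has_fps_expansion_imp_sums_complex[OF H, of r z] hol that by simp
  moreover have "deriv h 0 = 1"
    using fps_nth_fps_expansion[OF H, of 1] inv(3) by (simp add: H_eq s_coeff_def)
  ultimately show ?thesis using r(1) hol fh h0 by (intro that)
qed

section \<open>Properness over the upper half-plane\<close>

definition upper :: "complex set" where "upper = {z. Im z > 0}"
definition upper_preimage :: "complex set" where "upper_preimage = {w. Im w > 0 \<and> Im (f w) > 0}"

text \<open>Poles are excluded from \<^const>\<open>upper_preimage\<close> because \<^term>\<open>f\<close> has the junk value 0 there.\<close>

lemma upper_preimage_den: "w \<in> upper_preimage \<Longrightarrow> poly den w \<noteq> 0"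
  by (auto simp: upper_preimage_def f_def)

lemma f_holomorphic_upper_preimage: "f holomorphic_on upper_preimage"
  by (intro f_holomorphic upper_preimage_den)

lemma open_upper_preimage: "open upper_preimage"
proof -
  let ?S = "{w. poly den w \<noteq> 0}"
  have S: "open ?S" by (intro open_Collect_neq continuous_intros)
  have "open {w \<in> ?S. Im w > 0 \<and> Im (f w) > 0}"
  proof -
    have "continuous_on ?S (\<lambda>w. Im (f w))"
      by (intro continuous_intros holomorphic_on_imp_continuous_on f_holomorphic) auto
    then have "open (?S \<inter> (\<lambda>w. Im (f w)) -` {0<..})"
      using S by (intro continuous_open_preimage) auto
    moreover have "open {w. Im w > 0}" by (rule open_halfspace_Im_gt)
    ultimately have "open ((?S \<inter> (\<lambda>w. Im (f w)) -` {0<..}) \<inter> {w. Im w > 0})" by (rule open_Int)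
    also have "\<dots> = {w \<in> ?S. Im w > 0 \<and> Im (f w) > 0}" by auto
    finally show ?thesis .
  qed
  also have "{w \<in> ?S. Im w > 0 \<and> Im (f w) > 0} = upper_preimage"
    using upper_preimage_den by (auto simp: upper_preimage_def)
  finally show ?thesis .
qed

text \<open>
  A sequence tending to infinity cannot have its values under \<^term>\<open>f\<close> tend to a non-real
  number, as the value of the real rational function \<^term>\<open>f\<close> at infinity is real or infinite.
\<close>
lemma bounded_upper_preimage:
  assumes K: "compact K" "K \<subseteq> upper"
  shows "bounded (upper_preimage \<inter> f -` K)"
proof (rule ccontr)
  assume "\<not> bounded (upper_preimage \<inter> f -` K)"
  then have "\<exists>w. w \<in> upper_preimage \<inter> f -` K \<and> real k < norm w" for k
    unfolding bounded_iff by (metis not_le)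
  then obtain w where w: "\<And>k. w k \<in> upper_preimage \<inter> f -` K" "\<And>k. real k < norm (w k)"
    by metis
  have "filterlim (\<lambda>k. norm (w k)) at_top sequentially"
    by (rule filterlim_at_top_mono[OF filterlim_real_sequentially])
       (use w(2) in \<open>auto intro!: always_eventually less_imp_le\<close>)
  then have w_lim: "filterlim w at_infinity sequentially"
    by (rule filterlim_norm_at_top_imp_at_infinity)
  obtain z r where z: "z \<in> K" "strict_mono (r :: nat \<Rightarrow> nat)" "((\<lambda>k. f (w k)) \<circ> r) \<longlonglongrightarrow> z"
    using K(1) w(1) unfolding compact_def by (metis (no_types, lifting) IntD2 vimageE)
  \<comment> \<open>With this exponent, \<open>coeff num n\<close> and \<open>coeff den n\<close>
    cannot both be 0.\<close>
  define n where "n = max (degree num) (degree den)"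
  have lim: "(\<lambda>k. poly p (w (r k)) / w (r k) ^ n) \<longlonglongrightarrow> coeff p n" if "degree p \<le> n" for p
    using filterlim_compose[OF poly_over_power_tendsto[OF that] filterlim_compose[OF w_lim filterlim_subseq[OF z(2)]]]
    by simp
  have "(\<lambda>k. f (w (r k)) * (poly den (w (r k)) / w (r k) ^ n)) \<longlonglongrightarrow> z * coeff den n"
    using z(3) by (intro tendsto_mult lim) (auto simp: n_def o_def)
  moreover have "f (w (r k)) * (poly den (w (r k)) / w (r k) ^ n) = poly num (w (r k)) / w (r k) ^ n" for k
    using upper_preimage_den[of "w (r k)"] w(1)[of "r k"] by (auto simp: f_def)
  ultimately have "(\<lambda>k. poly num (w (r k)) / w (r k) ^ n) \<longlonglongrightarrow> z * coeff den n"
    by (simp only:)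
  moreover have "(\<lambda>k. poly num (w (r k)) / w (r k) ^ n) \<longlonglongrightarrow> coeff num n"
    by (intro lim) (simp add: n_def)
  ultimately have eq: "coeff num n = z * coeff den n" using LIMSEQ_unique by blast
  have "num = map_poly complex_of_real ([:0, 1:] * P)"
    by (simp only: map_poly_of_real_mult num_def) (simp add: map_poly_pCons)
  then have real: "coeff num n = complex_of_real (coeff ([:0, 1:] * P) n)"
      "coeff den n = complex_of_real (coeff Q n)"
    by (simp_all add: coeff_map_poly den_def)
  \<comment> \<open>Both coefficients are real and \<open>z\<close> is not, so the limit equation
    forces both to vanish.\<close>
  have "Im z * coeff Q n = 0" using arg_cong[OF eq, of Im] unfolding real by simp
  then have "coeff den n = 0" using z(1) K(2) by (auto simp: upper_def real)
  moreover from this eq have "coeff num n = 0" by simp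
  moreover have "num \<noteq> 0" using level_poly_nonzero[OF rep, of 0] by (simp add: level)
  moreover have "den \<noteq> 0" using den_0 by auto
  ultimately show False
    unfolding n_def by (cases "degree num \<le> degree den") (auto simp: max_def)
qed

text \<open>For closedness, a limit point \<open>l\<close> satisfies \<open>f l = z\<close> for some
  \<open>z\<close> in \<open>K\<close> and lies in the closed upper half-plane. It is not real,
  since \<open>f\<close> is real on the real axis.\<close>

lemma compact_upper_preimage:
  assumes K: "compact K" "K \<subseteq> upper"
  shows "compact (upper_preimage \<inter> f -` K)"
proof -
  have "closed (upper_preimage \<inter> f -` K)"
    unfolding closed_sequential_limits
  proof (intro allI impI, elim conjE)
    fix x l assume x: "\<forall>k. x k \<in> upper_preimage \<inter> f -` K" and l: "x \<longlonglongrightarrow> l"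
    obtain z r where z: "z \<in> K" "strict_mono (r :: nat \<Rightarrow> nat)" "((\<lambda>k. f (x k)) \<circ> r) \<longlonglongrightarrow> z"
      using K(1) x unfolding compact_def by (metis (no_types, lifting) IntD2 vimageE)
    have xr: "(\<lambda>k. x (r k)) \<longlonglongrightarrow> l" using LIMSEQ_subseq_LIMSEQ[OF l z(2)] by (simp add: o_def)
    have poly_lim: "(\<lambda>k. poly p (x (r k))) \<longlonglongrightarrow> poly p l" for p :: "complex poly"
      by (rule isCont_tendsto_compose[OF _ xr]) simp
    have "(\<lambda>k. f (x (r k)) * poly den (x (r k))) \<longlonglongrightarrow> z * poly den l"
      using z(3) by (intro tendsto_mult poly_lim) (simp add: o_def)
    moreover have "f (x (r k)) * poly den (x (r k)) = poly num (x (r k))" for k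
      using upper_preimage_den[of "x (r k)"] x by (auto simp: f_def)
    ultimately have "(\<lambda>k. poly num (x (r k))) \<longlonglongrightarrow> z * poly den l" by simp
    then have "poly num l = z * poly den l" using poly_lim by (rule LIMSEQ_unique[rotated])
    then have fl: "f l = z" by (rule f_eqI)
    have "Im l \<ge> 0"
      by (rule LIMSEQ_le_const[OF tendsto_Im[OF xr]])
         (use x in \<open>auto simp: upper_preimage_def less_imp_le\<close>)
    moreover have "Im l \<noteq> 0" using Im_f_real[of l] fl z(1) K(2) by (auto simp: upper_def)
    ultimately show "l \<in> upper_preimage \<inter> f -` K"
      using fl z(1) K(2) by (auto simp: upper_preimage_def upper_def)
  qed
  then show ?thesis using bounded_upper_preimage[OF K] by (simp add: compact_eq_bounded_closed)
qed

text \<open>Substituting \<open>num = f w * den\<close> at \<open>w\<close> into the quotient rule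
  leaves \<open>den\<close> times the derivative of the level polynomial at \<open>f w\<close>. So a
  zero of \<open>deriv f\<close> is a multiple root of it.\<close>

lemma deriv_f_nonzero:
  assumes "f w \<notin> crit_values F" "poly den w \<noteq> 0"
  shows "deriv f w \<noteq> 0"
proof
  assume d: "deriv f w = 0"
  define L where "L = level_poly P Q (f w)"
  have L: "L \<noteq> 0" using level_poly_nonzero[OF rep] by (simp add: L_def)
  have root: "poly L w = 0" using assms(2) by (simp add: L_def level f_def)
  have "(f has_field_derivative
      (poly (pderiv num) w * poly den w - poly num w * poly (pderiv den) w) / (poly den w * poly den w)) (at w)"
    unfolding f_def using assms(2) by (intro DERIV_divide poly_DERIV)
  then have "poly (pderiv num) w * poly den w - poly num w * poly (pderiv den) w = 0"
    using d assms(2) DERIV_imp_deriv by fastforce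
  moreover have "poly num w = f w * poly den w" using assms(2) by (simp add: f_def)
  ultimately have "poly den w * poly (pderiv L) w = 0"
    by (simp add: L_def level pderiv_diff pderiv_smult algebra_simps)
  then have root': "poly (pderiv L) w = 0" using assms(2) by simp
  \<comment> \<open>This is needed for \<open>order\<close> to detect the root of
    \<open>pderiv L\<close>; a constant \<open>L\<close> with a root would be 0.\<close>
  have "pderiv L \<noteq> 0"
  proof
    assume "pderiv L = 0"
    then obtain c where "L = [:c:]" by (metis pderiv_eq_0_iff degree_eq_zeroE)
    then show False using root L by simp
  qed
  then have "order w (pderiv L) \<noteq> 0" using root' by (simp add: order_root)
  then have "order w L \<ge> 2" using order_pderiv[OF L root] by simp
  then have "f w \<in> crit_values F" using rep by (auto simp: crit_values_def L_def)
  with assms(1) show False by simp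
qed

text \<open>The assumption on critical values enters here: values of \<open>f\<close> on
  \<open>upper_preimage\<close> are not real, hence not critical.\<close>

lemma covering_space_upper:
  assumes "crit_values F \<subseteq> \<real>" "upper_preimage \<noteq> {}"
  shows "covering_space upper_preimage f upper"
proof (rule covering_space_proper_holomorphic)
  show "open upper" unfolding upper_def by (rule open_halfspace_Im_gt)
  show "connected upper" unfolding upper_def by (intro convex_connected convex_halfspace_Im_gt)
  show "f ` upper_preimage \<subseteq> upper" by (auto simp: upper_preimage_def upper_def)
  show "deriv f w \<noteq> 0" if w: "w \<in> upper_preimage" for w
  proof (rule deriv_f_nonzero[OF _ upper_preimage_den[OF w]])
    have "f w \<notin> \<real>" using w by (auto simp: upper_preimage_def complex_is_Real_iff)
    then show "f w \<notin> crit_values F" using assms(1) by blast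
  qed
qed (use assms(2) open_upper_preimage f_holomorphic_upper_preimage compact_upper_preimage in auto)

text \<open>The function \<open>g\<close> is the lift through the covering \<open>f\<close> of the
  identity of the simply connected upper half-plane, started at a value of \<open>h\<close>.\<close>

lemma Pick_continuation:
  assumes "crit_values F \<subseteq> \<real>"
    and r: "r > 0" and h: "h holomorphic_on ball 0 r" and fh: "\<And>z. norm z < r \<Longrightarrow> f (h z) = z"
    and h': "deriv h 0 = 1" and h0: "h 0 = 0"
  obtains g where "g holomorphic_on upper" "\<And>z. z \<in> upper \<Longrightarrow> Im (g z) > 0"
    "\<And>z. \<lbrakk>z \<in> upper; norm z < r\<rbrakk> \<Longrightarrow> g z = h z"
proof -
  define S where "S = upper \<inter> ball 0 r"
  have convex_S: "convex S" unfolding S_def upper_def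
    by (intro convex_Int convex_ball convex_halfspace_Im_gt)
  have hS: "continuous_on S h"
    using holomorphic_on_imp_continuous_on[OF h] by (rule continuous_on_subset) (auto simp: S_def)
  \<comment> \<open>As \<open>h y / y\<close> tends to 1, a point \<open>\<i> * t\<close> with small
    positive \<open>t\<close> is sent close to itself: \<open>Im (\<i> * t * q) = t * Re q\<close>,
    where \<open>q\<close> is within 1/2 of 1.\<close>
  obtain a where a: "a \<in> S" "Im (h a) > 0"
  proof -
    have "(h has_field_derivative 1) (at 0)"
      using holomorphic_derivI[OF h open_ball, of 0] r h' by simp
    then have "((\<lambda>y. h y / y) \<longlongrightarrow> 1) (at 0)" by (simp add: DERIV_def h0)
    then have "\<forall>\<^sub>F y in at 0. dist (h y / y) 1 < 1 / 2" by (rule tendstoD) simp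
    then obtain d where d: "d > 0" "\<And>y. \<lbrakk>y \<noteq> 0; norm y < d\<rbrakk> \<Longrightarrow> dist (h y / y) 1 < 1 / 2"
      by (auto simp: eventually_at)
    define t where "t = min d r / 2"
    have t: "t > 0" "t < d" "t < r" using d(1) r by (auto simp: t_def)
    define q where "q = h (\<i> * t) / (\<i> * t)"
    have "norm (q - 1) < 1 / 2"
      using d(2)[of "\<i> * t"] t by (simp add: q_def dist_norm norm_mult)
    then have "Re q > 0" using abs_Re_le_cmod[of "q - 1"] by (auto simp: abs_if split: if_splits)
    moreover have "h (\<i> * t) = \<i> * t * q" using t(1) by (simp add: q_def)
    ultimately have "Im (h (\<i> * t)) > 0" using t(1) by simp
    moreover have "\<i> * t \<in> S" using t by (auto simp: S_def upper_def norm_mult)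
    ultimately show ?thesis using that by blast
  qed
  \<comment> \<open>A real \<open>h z\<close> would make \<open>f (h z) = z\<close> real. Hence
    \<open>Im (h z)\<close> keeps on the half-disc the sign it has at \<open>a\<close>.\<close>
  have "Im (h z) \<noteq> 0" if "z \<in> S" for z
    using that fh[of z] Im_f_real[of "h z"] by (auto simp: S_def upper_def)
  then have "Im (h z) > 0" if "z \<in> S" for z
    using Im_pos_connected[OF convex_connected[OF convex_S] hS _ a that] by blast
  then have h_img: "h z \<in> upper_preimage" if "z \<in> S" for z
    using that fh[of z] by (auto simp: S_def upper_preimage_def upper_def)
  have cov: "covering_space upper_preimage f upper"
    using covering_space_upper[OF assms(1)] h_img[OF a(1)] by blast
  have "a \<in> upper" "norm a < r" using a(1) by (auto simp: S_def)
  have convex: "convex upper" unfolding upper_def by (rule convex_halfspace_Im_gt)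
  obtain g where g: "continuous_on upper g" "g \<in> upper \<rightarrow> upper_preimage" "g a = h a"
      "\<And>z. z \<in> upper \<Longrightarrow> f (g z) = z"
  proof (rule covering_space_lift_strong[OF cov h_img[OF a(1)] \<open>a \<in> upper\<close>, where f = "\<lambda>z. z"])
    show "simply_connected upper" using convex by (rule convex_imp_simply_connected)
    show "locally path_connected upper" using convex by (rule convex_imp_locally_path_connected)
    show "a = f (h a)" using fh[OF \<open>norm a < r\<close>] by simp
  qed (use that in auto)
  show ?thesis
  proof
    show "g holomorphic_on upper"
      by (rule covering_space_lift_is_holomorphic[OF cov open_upper_preimage
            f_holomorphic_upper_preimage, where f = "\<lambda>z. z"]) (use g in auto)
    show "Im (g z) > 0" if "z \<in> upper" for z
      using that g(2) by (auto simp: upper_preimage_def)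
    \<comment> \<open>On the connected half-disc \<open>S\<close> both functions lift the identity
      and agree at \<open>a\<close>.\<close>
    show "g z = h z" if "z \<in> upper" "norm z < r" for z
    proof (rule covering_space_lift_unique[OF cov, where T = S and f = "\<lambda>z. z" and a = a and x = z
            and ?g1.0 = g and ?g2.0 = h])
      show "continuous_on S g" using g(1) by (rule continuous_on_subset) (auto simp: S_def)
    qed (use a that g h_img hS fh convex_connected[OF convex_S] in \<open>auto simp: S_def\<close>)
  qed
qed

end

theorem theorem2p3:
  fixes F :: "real poly fract"
  assumes "F \<in> rat_class"
    and "crit_values F \<subseteq> \<real>"
  shows "F \<in> rat_class_dist"
proof -
  obtain P Q where "represents F P Q" using assms(1) by (auto simp: rat_class_def)
  then interpret rational_representation F P Q by unfold_locales
  obtain r h where h: "r > 0" "h holomorphic_on ball 0 r"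
      "\<And>z. norm z < r \<Longrightarrow> (\<lambda>n. of_real (fps_nth (comp_inverse F) n) * z ^ n) sums h z"
      "\<And>z. norm z < r \<Longrightarrow> f (h z) = z" "h 0 = 0" "deriv h 0 = 1"
    by (rule local_inverse) (rule that; assumption)
  obtain g where g: "g holomorphic_on upper" "\<And>z. z \<in> upper \<Longrightarrow> Im (g z) > 0"
      "\<And>z. \<lbrakk>z \<in> upper; norm z < r\<rbrakk> \<Longrightarrow> g z = h z"
    by (rule Pick_continuation[OF assms(2) h(1,2,4,6,5)]) (assumption, (rule that; assumption))
  \<comment> \<open>The moment of order \<open>n\<close> is the coefficient of index
    \<open>Suc n\<close>, as the inverse series carries an extra factor \<open>z\<close>.\<close>
  have "\<exists>\<mu>. real_distribution \<mu> \<and> (\<forall>n. integrable \<mu> (\<lambda>x. x ^ n) \<and>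
      fps_nth (comp_inverse F) (Suc n) = (\<integral>x. x ^ n \<partial>\<mu>))"
  proof (rule moment_sequence_Pick_function[OF _ _ h(1,3)])
    show "g holomorphic_on {z. Im z > 0}" using g(1) by (simp add: upper_def)
    show "Im (g z) \<ge> 0" if "Im z > 0" for z using g(2)[of z] that by (simp add: upper_def)
    show "g z = h z" if "Im z > 0" "norm z < r" for z using g(3) that by (simp add: upper_def)
    show "fps_nth (comp_inverse F) (Suc 0) = 1"
      using comp_inverse(3)[OF assms(1)] by (simp add: s_coeff_def)
  qed
  then show ?thesis using assms(1) by (simp add: rat_class_dist_def s_coeff_def)
qed

end
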